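(* The system $\mathsf{P}$ proves $(\exists^{\mathrm{st}}\mu^{2})\mathsf{MU}(\mu)\rightarrow \Pi_{1}^{0}\text{-}\mathsf{TRANS} \rightarrow (\mu^{2})^{\mathrm{st}}$.
   Context: Work in Nelson-style nonstandard arithmetic: a predicate $\mathrm{st}(x)$ ("$x$ is standard") is added, with $(\forall^{\mathrm{st}}x)$, $(\exists^{\mathrm{st}}x)$ denoting quantifiers relativised to standard objects; a formula is internal if it does not involve $\mathrm{st}$. $\mathsf{E\text{-}PA}^{\omega*}$ is Peano arithmetic in all finite types with the axiom of extensionality, extended definitionally with types $\rho^{*}$ for finite sequences. $\mathsf{E\text{-}PA}^{\omega*}_{\mathrm{st}}$ is $\mathsf{E\text{-}PA}^{\omega*}$ plus the axiom schemas: $\mathrm{st}(x)\wedge x=y\rightarrow \mathrm{st}(y)$; $\mathrm{st}(t)$ for every closed term $t$; $\mathrm{st}(f)\wedge\mathrm{st}(x)\rightarrow\mathrm{st}(f(x))$; and external induction $\Phi(0)\wedge(\forall^{\mathrm{st}}n^{0})(\Phi(n)\rightarrow\Phi(n+1))\rightarrow(\forall^{\mathrm{st}}n^{0})\Phi(n)$ for any $\Phi$. The system $\mathsf{P}$ is $\mathsf{E\text{-}PA}^{\omega*}_{\mathrm{st}}+\mathsf{I}+\mathsf{HAC}_{\mathrm{int}}$, where, for internal $\varphi$, $\mathsf{HAC}_{\mathrm{int}}$ is $(\forall^{\mathrm{st}}x^{\rho})(\exists^{\mathrm{st}}y^{\tau})\varphi(x,y)\rightarrow (\exists^{\mathrm{st}}F^{\rho\rightarrow\tau^{*}})(\forall^{\mathrm{st}}x^{\rho})(\exists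 y^{\tau}\in F(x))\varphi(x,y)$, and $\mathsf{I}$ (Idealisation) is $(\forall^{\mathrm{st}}x^{\sigma^{*}})(\exists y^{\tau})(\forall z^{\sigma}\in x)\varphi(z,y)\rightarrow(\exists y^{\tau})(\forall^{\mathrm{st}}x^{\sigma})\varphi(x,y)$. $\mathsf{MU}(\mu)$ denotes $(\forall f^{1})((\exists n)f(n)=0\rightarrow f(\mu(f))=0)$; $(\mu^{2})$ is $(\exists\mu^{2})\mathsf{MU}(\mu)$, and $(\mu^{2})^{\mathrm{st}}$ is this formula with all quantifiers relativised to $\mathrm{st}$. $\Pi_{1}^{0}\text{-}\mathsf{TRANS}$ is the fragment of Transfer $(\forall^{\mathrm{st}}f^{1})[(\forall^{\mathrm{st}}n^{0})f(n)\neq 0\rightarrow(\forall m)f(m)\neq 0]$. *)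

theory Defs
  imports Main
begin

section \<open>Finite types and terms\<close>

datatype ty = N | Fn ty ty (infixr "\<rightarrow>" 80) | Sq ty

type_synonym var = "nat \<times> ty"

text \<open>
  The term language is the combinatory one: \<open>KC\<close>, \<open>SC\<close> are the combinators, \<open>Rec \<rho>\<close> is the Goedel
  recursor, \<open>LRec \<sigma> \<rho>\<close> is the list recursor that comes with the types of finite sequences.
\<close>

datatype con =
    Zero
  | Succ
  | KC ty ty
  | SC ty ty ty
  | Rec ty
  | Empty ty
  | Cons ty
  | LRec ty ty

datatype tm = Var var | Con con | App tm tm (infixl "\<cdot>" 100)

primrec con_type :: "con \<Rightarrow> ty" where
  "con_type Zero = N"
| "con_type Succ = N \<rightarrow> N"
| "con_type (KC \<sigma> \<tau>) = \<sigma> \<rightarrow> \<tau> \<rightarrow> \<sigma>"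
| "con_type (SC \<rho> \<sigma> \<tau>) = (\<rho> \<rightarrow> \<sigma> \<rightarrow> \<tau>) \<rightarrow> (\<rho> \<rightarrow> \<sigma>) \<rightarrow> \<rho> \<rightarrow> \<tau>"
| "con_type (Rec \<rho>) = N \<rightarrow> \<rho> \<rightarrow> (\<rho> \<rightarrow> N \<rightarrow> \<rho>) \<rightarrow> \<rho>"
| "con_type (Empty \<sigma>) = Sq \<sigma>"
| "con_type (Cons \<sigma>) = \<sigma> \<rightarrow> Sq \<sigma> \<rightarrow> Sq \<sigma>"
| "con_type (LRec \<sigma> \<rho>) = Sq \<sigma> \<rightarrow> \<rho> \<rightarrow> (\<rho> \<rightarrow> \<sigma> \<rightarrow> \<rho>) \<rightarrow> \<rho>"

primrec type_of :: "tm \<Rightarrow> ty option" where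
  "type_of (Var x) = Some (snd x)"
| "type_of (Con c) = Some (con_type c)"
| "type_of (t \<cdot> u) =
    (case type_of t of
       Some (\<sigma> \<rightarrow> \<tau>) \<Rightarrow> if type_of u = Some \<sigma> then Some \<tau> else None
     | _ \<Rightarrow> None)"

abbreviation has_type :: "tm \<Rightarrow> ty \<Rightarrow> bool" (infix "\<Colon>" 50) where
  "t \<Colon> \<sigma> \<equiv> type_of t = Some \<sigma>"

primrec fv_tm :: "tm \<Rightarrow> var set" where
  "fv_tm (Var x) = {x}"
| "fv_tm (Con c) = {}"
| "fv_tm (t \<cdot> u) = fv_tm t \<union> fv_tm u"

primrec subst_tm :: "var \<Rightarrow> tm \<Rightarrow> tm \<Rightarrow> tm" where
  "subst_tm x s (Var y) = (if y = x then s else Var y)"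
| "subst_tm x s (Con c) = Con c"
| "subst_tm x s (t \<cdot> u) = subst_tm x s t \<cdot> subst_tm x s u"

text \<open>An index larger than that of every variable of the term.\<close>

primrec fresh :: "tm \<Rightarrow> nat" where
  "fresh (Var x) = Suc (fst x)"
| "fresh (Con c) = 0"
| "fresh (t \<cdot> u) = max (fresh t) (fresh u)"

text \<open>Bracket abstraction: \<open>lam x t\<close> is the usual combinatory term for \<open>\<lambda>x. t\<close> (for well-typed \<open>t\<close>).\<close>

primrec lam :: "var \<Rightarrow> tm \<Rightarrow> tm" where
  "lam x (Var y) =
    (if y = x
     then Con (SC (snd x) (snd x \<rightarrow> snd x) (snd x)) \<cdot> Con (KC (snd x) (snd x \<rightarrow> snd x))
            \<cdot> Con (KC (snd x) (snd x))
     else Con (KC (snd y) (snd x)) \<cdot> Var y)"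
| "lam x (Con c) = Con (KC (con_type c) (snd x)) \<cdot> Con c"
| "lam x (t \<cdot> u) =
    Con (SC (snd x) (the (type_of u)) (the (type_of (t \<cdot> u)))) \<cdot> lam x t \<cdot> lam x u"

abbreviation zero :: tm where
  "zero \<equiv> Con Zero"

abbreviation succ :: "tm \<Rightarrow> tm" where
  "succ t \<equiv> Con Succ \<cdot> t"

definition add :: "tm \<Rightarrow> tm \<Rightarrow> tm" where
  "add t u = Con (Rec N) \<cdot> t \<cdot> u \<cdot> lam (0, N) (lam (1, N) (succ (Var (0, N))))"

primrec default :: "ty \<Rightarrow> tm" where
  "default N = zero"
| "default (\<sigma> \<rightarrow> \<tau>) = Con (KC \<tau> \<sigma>) \<cdot> default \<tau>"
| "default (Sq \<sigma>) = Con (Empty \<sigma>)"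

definition len :: "ty \<Rightarrow> tm \<Rightarrow> tm" where
  "len \<sigma> t = Con (LRec \<sigma> N) \<cdot> t \<cdot> zero \<cdot> lam (0, N) (lam (1, \<sigma>) (succ (Var (0, N))))"

text \<open>
  \<open>proj \<sigma> t i\<close> is the component \<open>(t)\<^sub>i\<close> of a sequence \<open>t\<close> of type \<open>\<sigma>\<^sup>*\<close>; it is \<open>default \<sigma>\<close> beyond the
  length of \<open>t\<close>.  By list recursion the function \<open>i \<mapsto> (t)\<^sub>i\<close> is constantly \<open>default \<sigma>\<close> for the empty
  sequence, and for the sequence with head \<open>a\<close> and tail function \<open>g\<close> it sends \<open>0\<close> to \<open>a\<close> and \<open>m + 1\<close>
  to \<open>g m\<close>.
\<close>

definition proj :: "ty \<Rightarrow> tm \<Rightarrow> tm \<Rightarrow> tm" where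
  "proj \<sigma> t i =
    Con (LRec \<sigma> (N \<rightarrow> \<sigma>)) \<cdot> t \<cdot> (Con (KC \<sigma> N) \<cdot> default \<sigma>)
      \<cdot> lam (0, N \<rightarrow> \<sigma>) (lam (1, \<sigma>) (lam (2, N)
          (Con (Rec \<sigma>) \<cdot> Var (2, N) \<cdot> Var (1, \<sigma>)
             \<cdot> lam (3, \<sigma>) (lam (4, N) (Var (0, N \<rightarrow> \<sigma>) \<cdot> Var (4, N))))))
      \<cdot> i"


section \<open>Formulas\<close>

datatype fm =
    Eq tm tm (infix "\<^bold>=" 50)
  | St tm
  | Bot
  | And fm fm (infixr "\<^bold>\<and>" 35)
  | Or fm fm (infixr "\<^bold>\<or>" 30)
  | Imp fm fm (infixr "\<^bold>\<longrightarrow>" 25)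
  | All var fm
  | Ex var fm

abbreviation Neg :: "fm \<Rightarrow> fm" ("\<^bold>\<not> _" [40] 40) where
  "\<^bold>\<not> \<phi> \<equiv> \<phi> \<^bold>\<longrightarrow> Bot"

abbreviation AllSt :: "var \<Rightarrow> fm \<Rightarrow> fm" where
  "AllSt x \<phi> \<equiv> All x (St (Var x) \<^bold>\<longrightarrow> \<phi>)"

abbreviation ExSt :: "var \<Rightarrow> fm \<Rightarrow> fm" where
  "ExSt x \<phi> \<equiv> Ex x (St (Var x) \<^bold>\<and> \<phi>)"

primrec wff :: "fm \<Rightarrow> bool" where
  "wff (t \<^bold>= u) \<longleftrightarrow> (\<exists>\<sigma>. t \<Colon> \<sigma> \<and> u \<Colon> \<sigma>)"
| "wff (St t) \<longleftrightarrow> (\<exists>\<sigma>. t \<Colon> \<sigma>)"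
| "wff Bot \<longleftrightarrow> True"
| "wff (\<phi> \<^bold>\<and> \<psi>) \<longleftrightarrow> wff \<phi> \<and> wff \<psi>"
| "wff (\<phi> \<^bold>\<or> \<psi>) \<longleftrightarrow> wff \<phi> \<and> wff \<psi>"
| "wff (\<phi> \<^bold>\<longrightarrow> \<psi>) \<longleftrightarrow> wff \<phi> \<and> wff \<psi>"
| "wff (All x \<phi>) \<longleftrightarrow> wff \<phi>"
| "wff (Ex x \<phi>) \<longleftrightarrow> wff \<phi>"

primrec internal :: "fm \<Rightarrow> bool" where
  "internal (t \<^bold>= u) \<longleftrightarrow> True"
| "internal (St t) \<longleftrightarrow> False"
| "internal Bot \<longleftrightarrow> True"
| "internal (\<phi> \<^bold>\<and> \<psi>) \<longleftrightarrow> internal \<phi> \<and> internal \<psi>"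
| "internal (\<phi> \<^bold>\<or> \<psi>) \<longleftrightarrow> internal \<phi> \<and> internal \<psi>"
| "internal (\<phi> \<^bold>\<longrightarrow> \<psi>) \<longleftrightarrow> internal \<phi> \<and> internal \<psi>"
| "internal (All x \<phi>) \<longleftrightarrow> internal \<phi>"
| "internal (Ex x \<phi>) \<longleftrightarrow> internal \<phi>"

primrec fv :: "fm \<Rightarrow> var set" where
  "fv (t \<^bold>= u) = fv_tm t \<union> fv_tm u"
| "fv (St t) = fv_tm t"
| "fv Bot = {}"
| "fv (\<phi> \<^bold>\<and> \<psi>) = fv \<phi> \<union> fv \<psi>"
| "fv (\<phi> \<^bold>\<or> \<psi>) = fv \<phi> \<union> fv \<psi>"
| "fv (\<phi> \<^bold>\<longrightarrow> \<psi>) = fv \<phi> \<union> fv \<psi>"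
| "fv (All x \<phi>) = fv \<phi> - {x}"
| "fv (Ex x \<phi>) = fv \<phi> - {x}"

text \<open>
  Substitution of \<open>s\<close> for the free occurrences of \<open>x\<close>.  Bound variables are not renamed, so it is only
  used when \<open>s\<close> is free for \<open>x\<close>.
\<close>

primrec subst :: "var \<Rightarrow> tm \<Rightarrow> fm \<Rightarrow> fm" where
  "subst x s (t \<^bold>= u) = (subst_tm x s t \<^bold>= subst_tm x s u)"
| "subst x s (St t) = St (subst_tm x s t)"
| "subst x s Bot = Bot"
| "subst x s (\<phi> \<^bold>\<and> \<psi>) = (subst x s \<phi> \<^bold>\<and> subst x s \<psi>)"
| "subst x s (\<phi> \<^bold>\<or> \<psi>) = (subst x s \<phi> \<^bold>\<or> subst x s \<psi>)"
| "subst x s (\<phi> \<^bold>\<longrightarrow> \<psi>) = (subst x s \<phi> \<^bold>\<longrightarrow> subst x s \<psi>)"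
| "subst x s (All y \<phi>) = All y (if y = x then \<phi> else subst x s \<phi>)"
| "subst x s (Ex y \<phi>) = Ex y (if y = x then \<phi> else subst x s \<phi>)"

primrec free_for :: "tm \<Rightarrow> var \<Rightarrow> fm \<Rightarrow> bool" where
  "free_for s x (t \<^bold>= u) \<longleftrightarrow> True"
| "free_for s x (St t) \<longleftrightarrow> True"
| "free_for s x Bot \<longleftrightarrow> True"
| "free_for s x (\<phi> \<^bold>\<and> \<psi>) \<longleftrightarrow> free_for s x \<phi> \<and> free_for s x \<psi>"
| "free_for s x (\<phi> \<^bold>\<or> \<psi>) \<longleftrightarrow> free_for s x \<phi> \<and> free_for s x \<psi>"
| "free_for s x (\<phi> \<^bold>\<longrightarrow> \<psi>) \<longleftrightarrow> free_for s x \<phi> \<and> free_for s x \<psi>"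
| "free_for s x (All y \<phi>) \<longleftrightarrow> x \<notin> fv (All y \<phi>) \<or> y \<notin> fv_tm s \<and> free_for s x \<phi>"
| "free_for s x (Ex y \<phi>) \<longleftrightarrow> x \<notin> fv (Ex y \<phi>) \<or> y \<notin> fv_tm s \<and> free_for s x \<phi>"

text \<open>Relativisation of all quantifiers to the standard objects.\<close>

primrec rel_st :: "fm \<Rightarrow> fm" where
  "rel_st (t \<^bold>= u) = (t \<^bold>= u)"
| "rel_st (St t) = St t"
| "rel_st Bot = Bot"
| "rel_st (\<phi> \<^bold>\<and> \<psi>) = (rel_st \<phi> \<^bold>\<and> rel_st \<psi>)"
| "rel_st (\<phi> \<^bold>\<or> \<psi>) = (rel_st \<phi> \<^bold>\<or> rel_st \<psi>)"
| "rel_st (\<phi> \<^bold>\<longrightarrow> \<psi>) = (rel_st \<phi> \<^bold>\<longrightarrow> rel_st \<psi>)"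
| "rel_st (All x \<phi>) = AllSt x (rel_st \<phi>)"
| "rel_st (Ex x \<phi>) = ExSt x (rel_st \<phi>)"

definition less :: "tm \<Rightarrow> tm \<Rightarrow> fm" where
  "less t u = (let k = (max (fresh t) (fresh u), N) in Ex k (add t (succ (Var k)) \<^bold>= u))"

text \<open>\<open>mem \<sigma> t u\<close> is \<open>t\<^sup>\<sigma> \<in> u\<close> for a sequence \<open>u\<close> of type \<open>\<sigma>\<^sup>*\<close>, i.e. \<open>(\<exists>i < |u|)(t = (u)\<^sub>i)\<close>.\<close>

definition mem :: "ty \<Rightarrow> tm \<Rightarrow> tm \<Rightarrow> fm" where
  "mem \<sigma> t u =
    (let i = (max (fresh t) (fresh u), N)
     in Ex i (less (Var i) (len \<sigma> u) \<^bold>\<and> t \<^bold>= proj \<sigma> u (Var i)))"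


section \<open>Derivability\<close>

text \<open>
  Classical many-sorted natural deduction over a set \<open>T\<close> of axioms.  The free variables of an axiom are
  implicitly universally quantified, hence \<open>T\<close> does not enter the eigenvariable conditions.
\<close>

inductive derives :: "fm set \<Rightarrow> fm set \<Rightarrow> fm \<Rightarrow> bool" for T :: "fm set" where
  Axiom: "\<phi> \<in> T \<Longrightarrow> derives T \<Gamma> \<phi>"
| Hyp: "\<phi> \<in> \<Gamma> \<Longrightarrow> wff \<phi> \<Longrightarrow> derives T \<Gamma> \<phi>"
| AndI: "derives T \<Gamma> \<phi> \<Longrightarrow> derives T \<Gamma> \<psi> \<Longrightarrow> derives T \<Gamma> (\<phi> \<^bold>\<and> \<psi>)"
| AndE1: "derives T \<Gamma> (\<phi> \<^bold>\<and> \<psi>) \<Longrightarrow> derives T \<Gamma> \<phi>"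
| AndE2: "derives T \<Gamma> (\<phi> \<^bold>\<and> \<psi>) \<Longrightarrow> derives T \<Gamma> \<psi>"
| OrI1: "derives T \<Gamma> \<phi> \<Longrightarrow> wff \<psi> \<Longrightarrow> derives T \<Gamma> (\<phi> \<^bold>\<or> \<psi>)"
| OrI2: "derives T \<Gamma> \<psi> \<Longrightarrow> wff \<phi> \<Longrightarrow> derives T \<Gamma> (\<phi> \<^bold>\<or> \<psi>)"
| OrE: "derives T \<Gamma> (\<phi> \<^bold>\<or> \<psi>) \<Longrightarrow> derives T (insert \<phi> \<Gamma>) \<chi> \<Longrightarrow> derives T (insert \<psi> \<Gamma>) \<chi>
    \<Longrightarrow> derives T \<Gamma> \<chi>"
| ImpI: "derives T (insert \<phi> \<Gamma>) \<psi> \<Longrightarrow> wff \<phi> \<Longrightarrow> derives T \<Gamma> (\<phi> \<^bold>\<longrightarrow> \<psi>)"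
| ImpE: "derives T \<Gamma> (\<phi> \<^bold>\<longrightarrow> \<psi>) \<Longrightarrow> derives T \<Gamma> \<phi> \<Longrightarrow> derives T \<Gamma> \<psi>"
| RAA: "derives T (insert (\<^bold>\<not> \<phi>) \<Gamma>) Bot \<Longrightarrow> wff \<phi> \<Longrightarrow> derives T \<Gamma> \<phi>"
| AllI: "derives T \<Gamma> \<phi> \<Longrightarrow> \<forall>\<gamma>\<in>\<Gamma>. x \<notin> fv \<gamma> \<Longrightarrow> derives T \<Gamma> (All x \<phi>)"
| AllE: "derives T \<Gamma> (All x \<phi>) \<Longrightarrow> t \<Colon> snd x \<Longrightarrow> free_for t x \<phi> \<Longrightarrow> derives T \<Gamma> (subst x t \<phi>)"
| ExI: "derives T \<Gamma> (subst x t \<phi>) \<Longrightarrow> t \<Colon> snd x \<Longrightarrow> free_for t x \<phi> \<Longrightarrow> wff \<phi>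
    \<Longrightarrow> derives T \<Gamma> (Ex x \<phi>)"
| ExE: "derives T \<Gamma> (Ex x \<phi>) \<Longrightarrow> derives T (insert \<phi> \<Gamma>) \<psi> \<Longrightarrow> \<forall>\<gamma>\<in>\<Gamma>. x \<notin> fv \<gamma> \<Longrightarrow> x \<notin> fv \<psi>
    \<Longrightarrow> derives T \<Gamma> \<psi>"

abbreviation proves :: "fm set \<Rightarrow> fm \<Rightarrow> bool" (infix "\<turnstile>" 20) where
  "T \<turnstile> \<phi> \<equiv> derives T {} \<phi>"


section \<open>The axiom systems\<close>

text \<open>
  Peano arithmetic in all finite types, with finite-sequence types.  Equality is primitive at every type;
  by extensionality and congruence, equality at \<open>\<sigma> \<rightarrow> \<tau>\<close> is provably pointwise equality, so this agrees
  with the presentation in which only equality at type \<open>N\<close> is primitive.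
\<close>

inductive_set EPA :: "fm set" where
  Refl: "t \<Colon> \<sigma> \<Longrightarrow> (t \<^bold>= t) \<in> EPA"
| Sym: "t \<Colon> \<sigma> \<Longrightarrow> u \<Colon> \<sigma> \<Longrightarrow> (t \<^bold>= u \<^bold>\<longrightarrow> u \<^bold>= t) \<in> EPA"
| Trans: "t \<Colon> \<sigma> \<Longrightarrow> u \<Colon> \<sigma> \<Longrightarrow> v \<Colon> \<sigma> \<Longrightarrow> (t \<^bold>= u \<^bold>\<longrightarrow> u \<^bold>= v \<^bold>\<longrightarrow> t \<^bold>= v) \<in> EPA"
| Cong: "f \<Colon> \<sigma> \<rightarrow> \<tau> \<Longrightarrow> g \<Colon> \<sigma> \<rightarrow> \<tau> \<Longrightarrow> t \<Colon> \<sigma> \<Longrightarrow> u \<Colon> \<sigma>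
    \<Longrightarrow> (f \<^bold>= g \<^bold>\<longrightarrow> t \<^bold>= u \<^bold>\<longrightarrow> f \<cdot> t \<^bold>= g \<cdot> u) \<in> EPA"
| Ext: "f \<Colon> \<sigma> \<rightarrow> \<tau> \<Longrightarrow> g \<Colon> \<sigma> \<rightarrow> \<tau> \<Longrightarrow> snd x = \<sigma> \<Longrightarrow> x \<notin> fv_tm f \<union> fv_tm g
    \<Longrightarrow> (All x (f \<cdot> Var x \<^bold>= g \<cdot> Var x) \<^bold>\<longrightarrow> f \<^bold>= g) \<in> EPA"
| Succ_neq_Zero: "t \<Colon> N \<Longrightarrow> (\<^bold>\<not> (succ t \<^bold>= zero)) \<in> EPA"
| Succ_inj: "t \<Colon> N \<Longrightarrow> u \<Colon> N \<Longrightarrow> (succ t \<^bold>= succ u \<^bold>\<longrightarrow> t \<^bold>= u) \<in> EPA"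
| Induction: "internal \<phi> \<Longrightarrow> wff \<phi> \<Longrightarrow> snd n = N
    \<Longrightarrow> (subst n zero \<phi> \<^bold>\<and> All n (\<phi> \<^bold>\<longrightarrow> subst n (succ (Var n)) \<phi>) \<^bold>\<longrightarrow> All n \<phi>) \<in> EPA"
| K_eq: "t \<Colon> \<sigma> \<Longrightarrow> u \<Colon> \<tau> \<Longrightarrow> (Con (KC \<sigma> \<tau>) \<cdot> t \<cdot> u \<^bold>= t) \<in> EPA"
| S_eq: "t \<Colon> \<rho> \<rightarrow> \<sigma> \<rightarrow> \<tau> \<Longrightarrow> u \<Colon> \<rho> \<rightarrow> \<sigma> \<Longrightarrow> v \<Colon> \<rho>
    \<Longrightarrow> (Con (SC \<rho> \<sigma> \<tau>) \<cdot> t \<cdot> u \<cdot> v \<^bold>= t \<cdot> v \<cdot> (u \<cdot> v)) \<in> EPA"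
| Rec_Zero: "u \<Colon> \<rho> \<Longrightarrow> v \<Colon> \<rho> \<rightarrow> N \<rightarrow> \<rho>
    \<Longrightarrow> (Con (Rec \<rho>) \<cdot> zero \<cdot> u \<cdot> v \<^bold>= u) \<in> EPA"
| Rec_Succ: "t \<Colon> N \<Longrightarrow> u \<Colon> \<rho> \<Longrightarrow> v \<Colon> \<rho> \<rightarrow> N \<rightarrow> \<rho>
    \<Longrightarrow> (Con (Rec \<rho>) \<cdot> succ t \<cdot> u \<cdot> v \<^bold>= v \<cdot> (Con (Rec \<rho>) \<cdot> t \<cdot> u \<cdot> v) \<cdot> t) \<in> EPA"
| Seq_cases: "t \<Colon> Sq \<sigma> \<Longrightarrow> a = (fresh t, \<sigma>) \<Longrightarrow> s = (fresh t, Sq \<sigma>)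
    \<Longrightarrow> (t \<^bold>= Con (Empty \<sigma>) \<^bold>\<or> Ex a (Ex s (t \<^bold>= Con (Cons \<sigma>) \<cdot> Var a \<cdot> Var s))) \<in> EPA"
| LRec_Empty: "u \<Colon> \<rho> \<Longrightarrow> v \<Colon> \<rho> \<rightarrow> \<sigma> \<rightarrow> \<rho>
    \<Longrightarrow> (Con (LRec \<sigma> \<rho>) \<cdot> Con (Empty \<sigma>) \<cdot> u \<cdot> v \<^bold>= u) \<in> EPA"
| LRec_Cons: "a \<Colon> \<sigma> \<Longrightarrow> s \<Colon> Sq \<sigma> \<Longrightarrow> u \<Colon> \<rho> \<Longrightarrow> v \<Colon> \<rho> \<rightarrow> \<sigma> \<rightarrow> \<rho>
    \<Longrightarrow> (Con (LRec \<sigma> \<rho>) \<cdot> (Con (Cons \<sigma>) \<cdot> a \<cdot> s) \<cdot> u \<cdot> v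
           \<^bold>= v \<cdot> (Con (LRec \<sigma> \<rho>) \<cdot> s \<cdot> u \<cdot> v) \<cdot> a) \<in> EPA"

inductive_set EPA_st :: "fm set" where
  EPA: "\<phi> \<in> EPA \<Longrightarrow> \<phi> \<in> EPA_st"
| St_eq: "t \<Colon> \<sigma> \<Longrightarrow> u \<Colon> \<sigma> \<Longrightarrow> (St t \<^bold>\<and> t \<^bold>= u \<^bold>\<longrightarrow> St u) \<in> EPA_st"
| St_closed: "t \<Colon> \<sigma> \<Longrightarrow> fv_tm t = {} \<Longrightarrow> St t \<in> EPA_st"
| St_app: "f \<Colon> \<sigma> \<rightarrow> \<tau> \<Longrightarrow> t \<Colon> \<sigma> \<Longrightarrow> (St f \<^bold>\<and> St t \<^bold>\<longrightarrow> St (f \<cdot> t)) \<in> EPA_st"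
| Ext_induction: "wff \<Phi> \<Longrightarrow> snd n = N
    \<Longrightarrow> (subst n zero \<Phi> \<^bold>\<and> AllSt n (\<Phi> \<^bold>\<longrightarrow> subst n (succ (Var n)) \<Phi>) \<^bold>\<longrightarrow> AllSt n \<Phi>) \<in> EPA_st"

text \<open>
  In \<open>I\<close> and \<open>HAC_int\<close> the formula \<open>\<phi>\<close> may have further free variables as parameters.  In \<open>I\<close> the variable
  \<open>z\<close> of type \<open>\<sigma>\<close> also serves as the standard variable of the conclusion.
\<close>

inductive_set sysP :: "fm set" where
  EPA_st: "\<phi> \<in> EPA_st \<Longrightarrow> \<phi> \<in> sysP"
| I: "internal \<phi> \<Longrightarrow> wff \<phi> \<Longrightarrow> snd z = \<sigma> \<Longrightarrow> snd x = Sq \<sigma> \<Longrightarrow> y \<noteq> z \<Longrightarrow> x \<noteq> y \<Longrightarrow> x \<notin> fv \<phi>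
    \<Longrightarrow> (AllSt x (Ex y (All z (mem \<sigma> (Var z) (Var x) \<^bold>\<longrightarrow> \<phi>))) \<^bold>\<longrightarrow> Ex y (AllSt z \<phi>)) \<in> sysP"
| HAC_int: "internal \<phi> \<Longrightarrow> wff \<phi> \<Longrightarrow> snd x = \<rho> \<Longrightarrow> snd y = \<tau> \<Longrightarrow> x \<noteq> y \<Longrightarrow> snd F = \<rho> \<rightarrow> Sq \<tau> \<Longrightarrow> F \<notin> fv \<phi>
    \<Longrightarrow> (AllSt x (ExSt y \<phi>)
          \<^bold>\<longrightarrow> ExSt F (AllSt x (Ex y (mem \<tau> (Var y) (Var F \<cdot> Var x) \<^bold>\<and> \<phi>)))) \<in> sysP"


section \<open>The principles\<close>

abbreviation ty1 :: ty where "ty1 \<equiv> N \<rightarrow> N"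
abbreviation ty2 :: ty where "ty2 \<equiv> ty1 \<rightarrow> N"

abbreviation var_f :: var where "var_f \<equiv> (0, ty1)"
abbreviation var_n :: var where "var_n \<equiv> (0, N)"
abbreviation var_mu :: var where "var_mu \<equiv> (0, ty2)"

definition MU :: "var \<Rightarrow> fm" where
  "MU \<mu> = All var_f (Ex var_n (Var var_f \<cdot> Var var_n \<^bold>= zero)
                      \<^bold>\<longrightarrow> Var var_f \<cdot> (Var \<mu> \<cdot> Var var_f) \<^bold>= zero)"

definition mu2 :: fm where
  "mu2 = Ex var_mu (MU var_mu)"

definition Pi01_TRANS :: fm where
  "Pi01_TRANS =
    AllSt var_f (AllSt var_n (\<^bold>\<not> (Var var_f \<cdot> Var var_n \<^bold>= zero))
                  \<^bold>\<longrightarrow> All var_n (\<^bold>\<not> (Var var_f \<cdot> Var var_n \<^bold>= zero)))"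

end

theory Submission
  imports Defs
begin

text \<open>
  For the first implication, a standard \<open>f\<close> with a zero has the zero \<open>\<mu>(f)\<close>, which is standard.

  For the second one, \<open>\<Pi>\<^sub>1\<^sup>0-TRANS\<close> says that a standard \<open>f\<close> with a zero has a standard zero, so that
  every standard \<open>f\<close> has a standard \<open>n\<close> satisfying the internal formula \<open>(\<exists>m. f(m) = 0) \<rightarrow> f(n) = 0\<close>.
  By \<open>HAC\<^sub>i\<^sub>n\<^sub>t\<close> a standard \<open>F\<close> yields finite sequences \<open>F(f)\<close> containing such an \<open>n\<close>, and \<open>\<mu>(f)\<close> is
  found by searching \<open>F(f)\<close> with a closed term defined by list recursion.
\<close>

section \<open>Substitution and derived rules\<close>

text \<open>All variables are replaced at once, so that the arguments of iterated abstractions can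
  be collected in one substitution.\<close>

primrec psubst :: "(var \<Rightarrow> tm) \<Rightarrow> tm \<Rightarrow> tm" where
  "psubst \<theta> (Var y) = \<theta> y"
| "psubst \<theta> (Con c) = Con c"
| "psubst \<theta> (t \<cdot> u) = psubst \<theta> t \<cdot> psubst \<theta> u"

lemma psubst_Var [simp]: "psubst Var t = t"
  by (induction t) auto

lemma subst_tm_fresh [simp]: "x \<notin> fv_tm t \<Longrightarrow> subst_tm x s t = t"
  by (induction t) auto

lemma subst_tm_Var_same [simp]: "subst_tm x (Var x) t = t"
  by (induction t) auto

lemma subst_Var_same [simp]: "subst x (Var x) \<phi> = \<phi>"
  by (induction \<phi>) auto

lemma free_for_Var_same [simp]: "free_for (Var x) x \<phi>"
  by (induction \<phi>) auto

section \<open>Typing and free variables of terms\<close>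

lemma has_type_App_iff: "t \<cdot> u \<Colon> \<tau> \<longleftrightarrow> (\<exists>\<sigma>. t \<Colon> \<sigma> \<rightarrow> \<tau> \<and> u \<Colon> \<sigma>)"
  by (auto split: option.splits ty.splits if_splits)

lemma has_type_psubst: "t \<Colon> \<tau> \<Longrightarrow> (\<And>y. \<theta> y \<Colon> snd y) \<Longrightarrow> psubst \<theta> t \<Colon> \<tau>"
proof (induction t arbitrary: \<tau>)
  case (App t u)
  then obtain \<sigma> where "t \<Colon> \<sigma> \<rightarrow> \<tau>" "u \<Colon> \<sigma>"
    unfolding has_type_App_iff by blast
  then show ?case using App by simp
qed auto

lemma type_of_psubst [simp]:
  "type_of t \<noteq> None \<Longrightarrow> \<forall>y. \<theta> y \<Colon> snd y \<Longrightarrow> type_of (psubst \<theta> t) = type_of t"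
  using has_type_psubst[of t _ \<theta>] by auto

lemma has_type_lam: "t \<Colon> \<tau> \<Longrightarrow> lam x t \<Colon> snd x \<rightarrow> \<tau>"
proof (induction t arbitrary: \<tau>)
  case (App t u)
  then obtain \<sigma> where "t \<Colon> \<sigma> \<rightarrow> \<tau>" "u \<Colon> \<sigma>"
    unfolding has_type_App_iff by blast
  then show ?case using App.IH by simp
qed auto

lemma type_of_lam [simp]:
  "type_of t \<noteq> None \<Longrightarrow> type_of (lam x t) = map_option (Fn (snd x)) (type_of t)"
  using has_type_lam[of t _ x] by auto

lemma fv_lam [simp]: "fv_tm (lam x t) = fv_tm t - {x}"
  by (induction t) auto

declare lam.simps [simp del]

lemma fv_default [simp]: "fv_tm (default \<sigma>) = {}"
  by (induction \<sigma>) auto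

lemma has_type_default [simp]: "default \<sigma> \<Colon> \<sigma>"
  by (induction \<sigma>) auto

text \<open>The instance is given through an equation, so that the simplifier computes it and no
  unification under \<open>subst\<close> is needed.\<close>

lemma derives_AllE:
  "derives T \<Gamma> (All x \<phi>) \<Longrightarrow> t \<Colon> snd x \<Longrightarrow> free_for t x \<phi> \<Longrightarrow> subst x t \<phi> = \<psi>
    \<Longrightarrow> derives T \<Gamma> \<psi>"
  using AllE by blast

lemma derives_ExI:
  "derives T \<Gamma> \<psi> \<Longrightarrow> subst x t \<phi> = \<psi> \<Longrightarrow> t \<Colon> snd x \<Longrightarrow> free_for t x \<phi> \<Longrightarrow> wff \<phi>
    \<Longrightarrow> derives T \<Gamma> (Ex x \<phi>)"
  using ExI by blast

lemma derives_EPA: "\<phi> \<in> EPA \<Longrightarrow> derives sysP \<Gamma> \<phi>"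
  by (intro Axiom sysP.EPA_st EPA_st.EPA)

text \<open>Internal induction reaches all numbers, not only the standard ones; with it the search
  is verified at arbitrary positions of a sequence.\<close>

lemma derives_induct:
  assumes "derives sysP \<Gamma> (subst n zero \<phi>)"
    and "derives sysP (insert \<phi> \<Gamma>) (subst n (succ (Var n)) \<phi>)"
    and "internal \<phi>" "wff \<phi>" "snd n = N" "\<forall>\<gamma>\<in>\<Gamma>. n \<notin> fv \<gamma>"
  shows "derives sysP \<Gamma> (All n \<phi>)"
  by (rule ImpE[OF derives_EPA[OF EPA.Induction]]) (use assms in \<open>auto intro!: AndI AllI ImpI\<close>)

lemma St_appI:
  "derives sysP \<Gamma> (St f) \<Longrightarrow> derives sysP \<Gamma> (St t) \<Longrightarrow> f \<Colon> \<sigma> \<rightarrow> \<tau> \<Longrightarrow> t \<Colon> \<sigma>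
    \<Longrightarrow> derives sysP \<Gamma> (St (f \<cdot> t))"
  by (rule ImpE[OF Axiom[OF sysP.EPA_st[OF EPA_st.St_app]]]) (auto intro: AndI)

lemma St_closedI: "t \<Colon> \<sigma> \<Longrightarrow> fv_tm t = {} \<Longrightarrow> derives sysP \<Gamma> (St t)"
  by (intro Axiom sysP.EPA_st EPA_st.St_closed)


section \<open>Typed provable equality\<close>

text \<open>The equality axioms of \<open>EPA\<close> carry typing premises; with the types bundled
  in, chains of equations discharge them along the way.\<close>

definition eqd :: "fm set \<Rightarrow> ty \<Rightarrow> tm \<Rightarrow> tm \<Rightarrow> bool" where
  "eqd \<Gamma> \<sigma> t u \<longleftrightarrow> derives sysP \<Gamma> (t \<^bold>= u) \<and> t \<Colon> \<sigma> \<and> u \<Colon> \<sigma>"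

lemma eqdD: "eqd \<Gamma> \<sigma> t u \<Longrightarrow> derives sysP \<Gamma> (t \<^bold>= u)"
  by (simp add: eqd_def)

section \<open>Equality axioms and defining equations as calculation rules\<close>

lemma eqd_refl: "t \<Colon> \<sigma> \<Longrightarrow> eqd \<Gamma> \<sigma> t t"
  unfolding eqd_def by (auto intro: derives_EPA EPA.Refl)

lemma eqd_sym: "eqd \<Gamma> \<sigma> t u \<Longrightarrow> eqd \<Gamma> \<sigma> u t"
  unfolding eqd_def by (auto intro: ImpE[OF derives_EPA[OF EPA.Sym]])

lemma eqd_trans [trans]: "eqd \<Gamma> \<sigma> t u \<Longrightarrow> eqd \<Gamma> \<sigma> u v \<Longrightarrow> eqd \<Gamma> \<sigma> t v"
  unfolding eqd_def by (auto intro: ImpE[OF ImpE[OF derives_EPA[OF EPA.Trans]]])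

lemma eqd_App: "eqd \<Gamma> (\<sigma> \<rightarrow> \<tau>) f g \<Longrightarrow> eqd \<Gamma> \<sigma> t u \<Longrightarrow> eqd \<Gamma> \<tau> (f \<cdot> t) (g \<cdot> u)"
  unfolding eqd_def by (auto intro: ImpE[OF ImpE[OF derives_EPA[OF EPA.Cong]]])

lemma eqd_arg: "f \<Colon> \<sigma> \<rightarrow> \<tau> \<Longrightarrow> eqd \<Gamma> \<sigma> t u \<Longrightarrow> eqd \<Gamma> \<tau> (f \<cdot> t) (f \<cdot> u)"
  by (rule eqd_App[OF eqd_refl])

lemma eqd_fun: "t \<Colon> \<sigma> \<Longrightarrow> eqd \<Gamma> (\<sigma> \<rightarrow> \<tau>) f g \<Longrightarrow> eqd \<Gamma> \<tau> (f \<cdot> t) (g \<cdot> t)"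
  by (rule eqd_App[OF _ eqd_refl])

lemma eqd_K: "t \<Colon> \<sigma> \<Longrightarrow> u \<Colon> \<tau> \<Longrightarrow> eqd \<Gamma> \<sigma> (Con (KC \<sigma> \<tau>) \<cdot> t \<cdot> u) t"
  unfolding eqd_def by (auto intro: derives_EPA EPA.K_eq)

lemma eqd_S:
  "t \<Colon> \<rho> \<rightarrow> \<sigma> \<rightarrow> \<tau> \<Longrightarrow> u \<Colon> \<rho> \<rightarrow> \<sigma> \<Longrightarrow> v \<Colon> \<rho>
    \<Longrightarrow> eqd \<Gamma> \<tau> (Con (SC \<rho> \<sigma> \<tau>) \<cdot> t \<cdot> u \<cdot> v) (t \<cdot> v \<cdot> (u \<cdot> v))"
  unfolding eqd_def by (auto intro: derives_EPA EPA.S_eq)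

lemma eqd_Rec_Zero:
  "u \<Colon> \<rho> \<Longrightarrow> v \<Colon> \<rho> \<rightarrow> N \<rightarrow> \<rho> \<Longrightarrow> eqd \<Gamma> \<rho> (Con (Rec \<rho>) \<cdot> zero \<cdot> u \<cdot> v) u"
  unfolding eqd_def by (auto intro: derives_EPA EPA.Rec_Zero)

lemma eqd_Rec_Succ:
  "t \<Colon> N \<Longrightarrow> u \<Colon> \<rho> \<Longrightarrow> v \<Colon> \<rho> \<rightarrow> N \<rightarrow> \<rho>
    \<Longrightarrow> eqd \<Gamma> \<rho> (Con (Rec \<rho>) \<cdot> succ t \<cdot> u \<cdot> v) (v \<cdot> (Con (Rec \<rho>) \<cdot> t \<cdot> u \<cdot> v) \<cdot> t)"
  unfolding eqd_def by (auto intro: derives_EPA EPA.Rec_Succ)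

lemma eqd_LRec_Empty:
  "u \<Colon> \<rho> \<Longrightarrow> v \<Colon> \<rho> \<rightarrow> \<sigma> \<rightarrow> \<rho>
    \<Longrightarrow> eqd \<Gamma> \<rho> (Con (LRec \<sigma> \<rho>) \<cdot> Con (Empty \<sigma>) \<cdot> u \<cdot> v) u"
  unfolding eqd_def by (auto intro: derives_EPA EPA.LRec_Empty)

lemma eqd_LRec_Cons:
  "a \<Colon> \<sigma> \<Longrightarrow> s \<Colon> Sq \<sigma> \<Longrightarrow> u \<Colon> \<rho> \<Longrightarrow> v \<Colon> \<rho> \<rightarrow> \<sigma> \<rightarrow> \<rho>
    \<Longrightarrow> eqd \<Gamma> \<rho> (Con (LRec \<sigma> \<rho>) \<cdot> (Con (Cons \<sigma>) \<cdot> a \<cdot> s) \<cdot> u \<cdot> v)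
          (v \<cdot> (Con (LRec \<sigma> \<rho>) \<cdot> s \<cdot> u \<cdot> v) \<cdot> a)"
  unfolding eqd_def by (auto intro: derives_EPA EPA.LRec_Cons)

text \<open>
  The outer substitution \<open>\<theta>\<close> is needed for iterated abstractions: \<open>subst_tm y s (lam x t)\<close> is in general
  not the term \<open>lam x (subst_tm y s t)\<close>.
\<close>

lemma eqd_beta:
  assumes "t \<Colon> \<tau>" "\<And>y. \<theta> y \<Colon> snd y" "u \<Colon> snd x"
  shows "eqd \<Gamma> \<tau> (psubst \<theta> (lam x t) \<cdot> u) (psubst (\<theta>(x := u)) t)"
  using assms(1)
proof (induction t arbitrary: \<tau>)
  case (Var y)
  show ?case
  proof (cases "y = x")
    case True
    let ?\<sigma> = "snd x"
    \<comment> \<open>The abstraction of \<open>x\<close> itself is the identity in the form S K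
      K.\<close>
    have "eqd \<Gamma> ?\<sigma> (Con (SC ?\<sigma> (?\<sigma> \<rightarrow> ?\<sigma>) ?\<sigma>) \<cdot> Con (KC ?\<sigma> (?\<sigma> \<rightarrow> ?\<sigma>)) \<cdot> Con (KC ?\<sigma> ?\<sigma>) \<cdot> u)
        (Con (KC ?\<sigma> (?\<sigma> \<rightarrow> ?\<sigma>)) \<cdot> u \<cdot> (Con (KC ?\<sigma> ?\<sigma>) \<cdot> u))"
      by (rule eqd_S) (use assms in auto)
    also have "eqd \<Gamma> ?\<sigma> \<dots> u"
      by (rule eqd_K) (use assms in auto)
    finally show ?thesis using True Var by (simp add: lam.simps)
  next
    case False
    then show ?thesis using Var assms(2)[of y] assms(3) by (auto simp: lam.simps intro: eqd_K)
  qed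
next
  case (Con c)
  then show ?case using assms by (auto simp: lam.simps intro: eqd_K)
next
  case (App t1 t2)
  then obtain \<sigma> where t: "t1 \<Colon> \<sigma> \<rightarrow> \<tau>" "t2 \<Colon> \<sigma>"
    unfolding has_type_App_iff by blast
  have "eqd \<Gamma> \<tau> (psubst \<theta> (lam x (t1 \<cdot> t2)) \<cdot> u)
      (psubst \<theta> (lam x t1) \<cdot> u \<cdot> (psubst \<theta> (lam x t2) \<cdot> u))"
    using eqd_S[OF has_type_psubst[OF has_type_lam[OF t(1)] assms(2)]
        has_type_psubst[OF has_type_lam[OF t(2)] assms(2)] assms(3)] t
    by (simp add: lam.simps)
  also have "eqd \<Gamma> \<tau> \<dots> (psubst (\<theta>(x := u)) t1 \<cdot> psubst (\<theta>(x := u)) t2)"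
    by (rule eqd_App[OF App.IH(1)[OF t(1)] App.IH(2)[OF t(2)]])
  finally show ?case by (simp only: psubst.simps)
qed

text \<open>The first contraction leaves the inner abstraction intact and records its argument in
  the substitution, so \<open>eqd_beta\<close> applies again. The later update wins, as an inner
  binder shadows an outer one.\<close>

lemma eqd_beta2:
  assumes "t \<Colon> \<tau>" "\<And>y. \<theta> y \<Colon> snd y" "u \<Colon> snd x" "v \<Colon> snd y"
  shows "eqd \<Gamma> \<tau> (psubst \<theta> (lam x (lam y t)) \<cdot> u \<cdot> v) (psubst (\<theta>(x := u, y := v)) t)"
  by (rule eqd_trans[OF eqd_fun[OF _ eqd_beta[OF has_type_lam]] eqd_beta]) (use assms in auto)

lemma eqd_beta3:
  assumes "t \<Colon> \<tau>" "\<And>y. \<theta> y \<Colon> snd y" "u \<Colon> snd x" "v \<Colon> snd y" "w \<Colon> snd z"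
  shows "eqd \<Gamma> \<tau> (psubst \<theta> (lam x (lam y (lam z t))) \<cdot> u \<cdot> v \<cdot> w)
    (psubst (\<theta>(x := u, y := v, z := w)) t)"
  by (rule eqd_trans[OF eqd_fun[OF _ eqd_beta2[OF has_type_lam]] eqd_beta]) (use assms in auto)


section \<open>Components of sequences\<close>

lemma has_type_proj: "t \<Colon> Sq \<sigma> \<Longrightarrow> i \<Colon> N \<Longrightarrow> proj \<sigma> t i \<Colon> \<sigma>"
  by (simp add: proj_def)

lemma fv_proj [simp]: "fv_tm (proj \<sigma> t i) = fv_tm t \<union> fv_tm i"
  by (auto simp: proj_def)

text \<open>The default value and the step function inside \<open>proj\<close> are closed
  terms.\<close>

lemma subst_tm_proj [simp]: "subst_tm x s (proj \<sigma> t i) = proj \<sigma> (subst_tm x s t) (subst_tm x s i)"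
  by (auto simp: proj_def intro!: subst_tm_fresh)

lemma eqd_proj:
  "eqd \<Gamma> (Sq \<sigma>) t u \<Longrightarrow> eqd \<Gamma> N i j \<Longrightarrow> eqd \<Gamma> \<sigma> (proj \<sigma> t i) (proj \<sigma> u j)"
  unfolding proj_def
  by (rule eqd_App[OF eqd_fun[OF _ eqd_fun[OF _ eqd_arg]]]) (auto simp: has_type_lam)

lemma eqd_proj_Empty: "i \<Colon> N \<Longrightarrow> eqd \<Gamma> \<sigma> (proj \<sigma> (Con (Empty \<sigma>)) i) (default \<sigma>)"
  unfolding proj_def
  by (rule eqd_trans[OF eqd_fun[OF _ eqd_LRec_Empty] eqd_K]) auto

context
  fixes \<sigma> :: ty and a s :: tm
  assumes a: "a \<Colon> \<sigma>" and s: "s \<Colon> Sq \<sigma>"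
begin

private abbreviation (input) step :: tm where
  "step \<equiv> lam (0, N \<rightarrow> \<sigma>) (lam (1, \<sigma>) (lam (2, N)
     (Con (Rec \<sigma>) \<cdot> Var (2, N) \<cdot> Var (1, \<sigma>)
        \<cdot> lam (3, \<sigma>) (lam (4, N) (Var (0, N \<rightarrow> \<sigma>) \<cdot> Var (4, N))))))"

private abbreviation (input) tail :: tm where
  "tail \<equiv> Con (LRec \<sigma> (N \<rightarrow> \<sigma>)) \<cdot> s \<cdot> (Con (KC \<sigma> N) \<cdot> default \<sigma>) \<cdot> step"

text \<open>The successor clause of the case distinction, kept in the form that
  \<open>eqd_beta3\<close> leaves, so that \<open>eqd_beta2\<close> applies to it directly.\<close>

private abbreviation (input) shift :: "tm \<Rightarrow> tm" where
  "shift i \<equiv> psubst (Var((0, N \<rightarrow> \<sigma>) := tail, (1, \<sigma>) := a, (2, N) := i))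
     (lam (3, \<sigma>) (lam (4, N) (Var (0, N \<rightarrow> \<sigma>) \<cdot> Var (4, N))))"

private lemma has_type_step: "step \<Colon> (N \<rightarrow> \<sigma>) \<rightarrow> \<sigma> \<rightarrow> N \<rightarrow> \<sigma>"
  by simp

private lemma has_type_tail: "tail \<Colon> N \<rightarrow> \<sigma>"
  using s by simp

text \<open>After list recursion and three contractions, a component of a nonempty sequence is a
  case distinction on the index, made by the recursor.\<close>

private lemma eqd_proj_Cons:
  assumes i: "i \<Colon> N"
  shows "eqd \<Gamma> \<sigma> (proj \<sigma> (Con (Cons \<sigma>) \<cdot> a \<cdot> s) i) (Con (Rec \<sigma>) \<cdot> i \<cdot> a \<cdot> shift i)"
proof -
  have "eqd \<Gamma> \<sigma> (proj \<sigma> (Con (Cons \<sigma>) \<cdot> a \<cdot> s) i) (step \<cdot> tail \<cdot> a \<cdot> i)"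
    unfolding proj_def
    by (rule eqd_fun[OF i eqd_LRec_Cons[OF a s _ has_type_step]]) simp
  also have "eqd \<Gamma> \<sigma> \<dots> (Con (Rec \<sigma>) \<cdot> i \<cdot> a \<cdot> shift i)"
    using eqd_beta3[where \<theta> = Var and u = tail and v = a and w = i and x = "(0, N \<rightarrow> \<sigma>)"
        and y = "(1, \<sigma>)" and z = "(2, N)" and \<tau> = \<sigma> and \<Gamma> = \<Gamma>
        and t = "Con (Rec \<sigma>) \<cdot> Var (2, N) \<cdot> Var (1, \<sigma>)
          \<cdot> lam (3, \<sigma>) (lam (4, N) (Var (0, N \<rightarrow> \<sigma>) \<cdot> Var (4, N)))"] a i s
    by simp
  finally show ?thesis .
qed

lemma eqd_proj_Cons_zero: "eqd \<Gamma> \<sigma> (proj \<sigma> (Con (Cons \<sigma>) \<cdot> a \<cdot> s) zero) a"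
  by (rule eqd_trans[OF eqd_proj_Cons eqd_Rec_Zero]) (use a s in simp_all)

lemma eqd_proj_Cons_succ:
  assumes i: "i \<Colon> N"
  shows "eqd \<Gamma> \<sigma> (proj \<sigma> (Con (Cons \<sigma>) \<cdot> a \<cdot> s) (succ i)) (proj \<sigma> s i)"
proof -
  let ?\<theta> = "Var((0, N \<rightarrow> \<sigma>) := tail, (1, \<sigma>) := a, (2, N) := succ i)"
  have \<theta>: "?\<theta> y \<Colon> snd y" for y
    using a i has_type_tail by simp
  have sh: "shift (succ i) \<Colon> \<sigma> \<rightarrow> N \<rightarrow> \<sigma>"
    using \<theta> by (intro has_type_psubst) simp_all
  have "eqd \<Gamma> \<sigma> (proj \<sigma> (Con (Cons \<sigma>) \<cdot> a \<cdot> s) (succ i))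
      (Con (Rec \<sigma>) \<cdot> succ i \<cdot> a \<cdot> shift (succ i))"
    by (rule eqd_proj_Cons) (use i in simp)
  also have "eqd \<Gamma> \<sigma> \<dots> (shift (succ i) \<cdot> (Con (Rec \<sigma>) \<cdot> i \<cdot> a \<cdot> shift (succ i)) \<cdot> i)"
    by (rule eqd_Rec_Succ[OF i a sh])
  \<comment> \<open>This contraction discards the recursive value and applies the tail function to
    the predecessor \<open>i\<close>.\<close>
  also have "eqd \<Gamma> \<sigma> \<dots> (psubst (?\<theta>((3, \<sigma>) := Con (Rec \<sigma>) \<cdot> i \<cdot> a \<cdot> shift (succ i), (4, N) := i))
      (Var (0, N \<rightarrow> \<sigma>) \<cdot> Var (4, N)))"
    by (rule eqd_beta2[OF _ \<theta>]) (use a i s in simp_all)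
  finally show ?thesis
    by (simp add: proj_def)
qed

end


section \<open>Searching a sequence for a zero\<close>

text \<open>The recursor on the value of \<open>f\<close> at the head acts as a conditional: at zero
  it gives the head, while the successor clause, made constant by two \<open>KC\<close>, gives the
  result for the tail.\<close>

definition search_step :: tm where
  "search_step = lam (0, ty1) (lam (0, N) (lam (1, N)
     (Con (Rec N) \<cdot> (Var (0, ty1) \<cdot> Var (1, N)) \<cdot> Var (1, N)
        \<cdot> (Con (KC (N \<rightarrow> N) N) \<cdot> (Con (KC N N) \<cdot> Var (0, N))))))"

text \<open>
  \<open>search \<cdot> f \<cdot> s\<close> is the first component \<open>a\<close> of \<open>s\<close> with \<open>f \<cdot> a = 0\<close>, or else \<open>0\<close>.  This default is also
  the value of components beyond the length of \<open>s\<close>, so lengths play no role below.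
\<close>

definition search :: tm where
  "search = lam (0, ty1) (lam (0, Sq N)
     (Con (LRec N N) \<cdot> Var (0, Sq N) \<cdot> zero \<cdot> (search_step \<cdot> Var (0, ty1))))"

lemma has_type_search_step [simp]: "search_step \<Colon> ty1 \<rightarrow> N \<rightarrow> N \<rightarrow> N"
  by (simp add: search_step_def)

lemma fv_search_step [simp]: "fv_tm search_step = {}"
  by (auto simp add: search_step_def)

lemma psubst_closed: "fv_tm t = {} \<Longrightarrow> psubst \<theta> t = t"
  by (induction t) auto

lemma has_type_search [simp]: "search \<Colon> ty1 \<rightarrow> Sq N \<rightarrow> N"
  by (simp add: search_def)

lemma fv_search [simp]: "fv_tm search = {}"
  by (auto simp: search_def)

context
  fixes f :: tm
  assumes f: "f \<Colon> ty1"
begin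

lemma eqd_search:
  assumes "s \<Colon> Sq N"
  shows "eqd \<Gamma> N (search \<cdot> f \<cdot> s) (Con (LRec N N) \<cdot> s \<cdot> zero \<cdot> (search_step \<cdot> f))"
  unfolding search_def
  using eqd_beta2[where \<theta> = Var and u = f and v = s and x = "(0, ty1)" and y = "(0, Sq N)"
      and \<tau> = N and \<Gamma> = \<Gamma>
      and t = "Con (LRec N N) \<cdot> Var (0, Sq N) \<cdot> zero \<cdot> (search_step \<cdot> Var (0, ty1))"] f assms
  by (simp add: psubst_closed)

lemma eqd_search_Empty: "eqd \<Gamma> N (search \<cdot> f \<cdot> Con (Empty N)) zero"
  by (rule eqd_trans[OF eqd_search eqd_LRec_Empty]) (use f in simp_all)

lemma eqd_search_Cons:
  assumes a: "a \<Colon> N" and s: "s \<Colon> Sq N"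
  shows "eqd \<Gamma> N (search \<cdot> f \<cdot> (Con (Cons N) \<cdot> a \<cdot> s))
    (Con (Rec N) \<cdot> (f \<cdot> a) \<cdot> a \<cdot> (Con (KC (N \<rightarrow> N) N) \<cdot> (Con (KC N N) \<cdot> (search \<cdot> f \<cdot> s))))"
proof -
  let ?r = "Con (LRec N N) \<cdot> s \<cdot> zero \<cdot> (search_step \<cdot> f)"
  have "eqd \<Gamma> N (search \<cdot> f \<cdot> (Con (Cons N) \<cdot> a \<cdot> s))
      (Con (LRec N N) \<cdot> (Con (Cons N) \<cdot> a \<cdot> s) \<cdot> zero \<cdot> (search_step \<cdot> f))"
    by (rule eqd_search) (use a s in simp)
  also have "eqd \<Gamma> N \<dots> (search_step \<cdot> f \<cdot> ?r \<cdot> a)"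
    by (rule eqd_LRec_Cons) (use f a s in simp_all)
  also have "eqd \<Gamma> N \<dots> (Con (Rec N) \<cdot> (f \<cdot> a) \<cdot> a \<cdot> (Con (KC (N \<rightarrow> N) N) \<cdot> (Con (KC N N) \<cdot> ?r)))"
    using eqd_beta3[where \<theta> = Var and u = f and v = ?r and w = a and x = "(0, ty1)" and y = "(0, N)"
        and z = "(1, N)" and \<tau> = N and \<Gamma> = \<Gamma>
        and t = "Con (Rec N) \<cdot> (Var (0, ty1) \<cdot> Var (1, N)) \<cdot> Var (1, N)
          \<cdot> (Con (KC (N \<rightarrow> N) N) \<cdot> (Con (KC N N) \<cdot> Var (0, N)))"] f a s
    by (simp add: search_step_def)
  \<comment> \<open>The recursion on the tail is folded back into \<open>search\<close>, the form in
    which the induction hypothesis will speak of it.\<close>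
  also have "eqd \<Gamma> N \<dots> (Con (Rec N) \<cdot> (f \<cdot> a) \<cdot> a
      \<cdot> (Con (KC (N \<rightarrow> N) N) \<cdot> (Con (KC N N) \<cdot> (search \<cdot> f \<cdot> s))))"
    by (rule eqd_arg[OF _ eqd_arg[OF _ eqd_arg[OF _ eqd_sym[OF eqd_search]]]]) (use f a s in simp_all)
  finally show ?thesis .
qed

end

section \<open>Correctness of the search\<close>

lemma derives_zero_transport:
  assumes "derives sysP \<Gamma> (f \<cdot> t \<^bold>= zero)" "eqd \<Gamma> N u t" "f \<Colon> ty1"
  shows "derives sysP \<Gamma> (f \<cdot> u \<^bold>= zero)"
proof -
  have "eqd \<Gamma> N (f \<cdot> u) (f \<cdot> t)"
    by (rule eqd_arg[OF assms(3,2)])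
  also have "eqd \<Gamma> N \<dots> zero"
    using assms by (auto simp: eqd_def)
  finally show ?thesis by (rule eqdD)
qed

text \<open>The conditional yields \<open>a\<close> if \<open>f\<close> vanishes at \<open>a\<close>
  and \<open>r\<close> otherwise, a zero of \<open>f\<close> in both cases. The case distinction is
  an induction on \<open>n\<close> under the premise that \<open>f\<close> has the value
  \<open>n\<close> at \<open>a\<close>.\<close>

lemma derives_zero_if:
  assumes f: "f \<Colon> ty1" and a: "a \<Colon> N" and r: "r \<Colon> N"
    and zero_r: "derives sysP \<Gamma> (f \<cdot> r \<^bold>= zero)"
    and x: "snd x = N" "x \<notin> fv_tm f \<union> fv_tm a \<union> fv_tm r" "\<forall>\<gamma>\<in>\<Gamma>. x \<notin> fv \<gamma>"
  shows "derives sysP \<Gamma>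
    (f \<cdot> (Con (Rec N) \<cdot> (f \<cdot> a) \<cdot> a \<cdot> (Con (KC (N \<rightarrow> N) N) \<cdot> (Con (KC N N) \<cdot> r))) \<^bold>= zero)"
proof -
  let ?k = "Con (KC (N \<rightarrow> N) N) \<cdot> (Con (KC N N) \<cdot> r)"
  let ?if = "\<lambda>n. Con (Rec N) \<cdot> n \<cdot> a \<cdot> ?k"
  \<comment> \<open>Having the zero \<open>r\<close> as a premise of the formula makes it a
    hypothesis in the enlarged contexts, so \<open>zero_r\<close> need not be weakened.\<close>
  let ?\<phi> = "\<lambda>n. f \<cdot> r \<^bold>= zero \<^bold>\<longrightarrow> f \<cdot> a \<^bold>= n \<^bold>\<longrightarrow> f \<cdot> ?if n \<^bold>= zero"
  have "derives sysP \<Gamma> (All x (?\<phi> (Var x)))"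
  proof (rule derives_induct)
    have "derives sysP \<Gamma> (?\<phi> zero)"
      by (rule ImpI, rule ImpI, rule derives_zero_transport[OF Hyp eqd_Rec_Zero])
        (use f a r in simp_all)
    then show "derives sysP \<Gamma> (subst x zero (?\<phi> (Var x)))"
      using x by simp
    have "eqd \<Delta> N (?if (succ (Var x))) r" for \<Delta>
    proof -
      have "eqd \<Delta> N (?if (succ (Var x))) (?k \<cdot> ?if (Var x) \<cdot> Var x)"
        by (rule eqd_Rec_Succ) (use a r x in simp_all)
      also have "eqd \<Delta> N \<dots> (Con (KC N N) \<cdot> r \<cdot> Var x)"
        by (rule eqd_fun[OF _ eqd_K]) (use a r x in simp_all)
      also have "eqd \<Delta> N \<dots> r"
        by (rule eqd_K) (use r x in simp_all)
      finally show ?thesis .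
    qed
    then have "derives sysP (insert (?\<phi> (Var x)) \<Gamma>) (?\<phi> (succ (Var x)))"
      by (intro ImpI derives_zero_transport[OF Hyp, of f r]) (use f a r x in simp_all)
    then show "derives sysP (insert (?\<phi> (Var x)) \<Gamma>) (subst x (succ (Var x)) (?\<phi> (Var x)))"
      using x by simp
  qed (use f a r x in auto)
  then have "derives sysP \<Gamma> (?\<phi> (f \<cdot> a))"
    by (rule derives_AllE[where t = "f \<cdot> a"]) (use f a x in simp_all)
  then show ?thesis
    by (rule ImpE[OF ImpE[OF _ zero_r] eqdD[OF eqd_refl[of _ N]]]) (use f a in simp)
qed

text \<open>\<open>ExE\<close> keeps what it eliminates, so both existential formulas stay in the
  context beside their common instance \<open>C\<close>.\<close>

lemma derives_Seq_cases:
  fixes t a s \<sigma>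
  defines "C \<equiv> t \<^bold>= Con (Cons \<sigma>) \<cdot> Var a \<cdot> Var s"
  assumes t: "t \<Colon> Sq \<sigma>" and as: "a = (fresh t, \<sigma>)" "s = (fresh t, Sq \<sigma>)"
    and empty: "derives sysP (insert (t \<^bold>= Con (Empty \<sigma>)) \<Gamma>) \<psi>"
    and cons: "derives sysP ({C, Ex s C, Ex a (Ex s C)} \<union> \<Gamma>) \<psi>"
    and fresh: "\<forall>\<gamma>\<in>\<Gamma>. a \<notin> fv \<gamma> \<and> s \<notin> fv \<gamma>" "a \<notin> fv \<psi>" "s \<notin> fv \<psi>"
  shows "derives sysP \<Gamma> \<psi>"
proof -
  have C: "wff C"
    using t as by (simp add: C_def)
  have "derives sysP (insert (Ex s C) (insert (Ex a (Ex s C)) \<Gamma>)) \<psi>"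
    by (rule ExE[where x = s and \<phi> = C, OF Hyp]) (use C cons fresh in simp_all)
  then have "derives sysP (insert (Ex a (Ex s C)) \<Gamma>) \<psi>"
    by (rule ExE[where x = a and \<phi> = "Ex s C", OF Hyp, rotated 2]) (use C fresh in simp_all)
  then show ?thesis
    by (rule OrE[OF derives_EPA[OF EPA.Seq_cases[OF t as]] empty, folded C_def])
qed

text \<open>Induction on the position, with the sequence quantified inside: position
  \<open>i + 1\<close> of a nonempty sequence is position \<open>i\<close> of its tail. The bound
  \<open>k\<close> makes all variables of index \<open>k\<close> or more fresh for \<open>f\<close>
  and \<open>\<Gamma>\<close>.\<close>

lemma derives_search:
  assumes f: "f \<Colon> ty1" and k: "\<forall>x\<in>fv_tm f. fst x < k" "\<forall>\<gamma>\<in>\<Gamma>. \<forall>x\<in>fv \<gamma>. fst x < k"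
  shows "derives sysP \<Gamma> (All (k, N) (All (k, Sq N)
    (f \<cdot> proj N (Var (k, Sq N)) (Var (k, N)) \<^bold>= zero \<^bold>\<longrightarrow> f \<cdot> (search \<cdot> f \<cdot> Var (k, Sq N)) \<^bold>= zero)))"
proof -
  \<comment> \<open>\<open>Seq_cases\<close> prescribes \<open>fresh (Var ?s) = Suc k\<close> as the
    index of the head and tail variables.\<close>
  let ?i = "(k, N)" and ?s = "(k, Sq N)" and ?a = "(Suc k, N)" and ?s' = "(Suc k, Sq N)"
  let ?\<psi> = "\<lambda>j s. f \<cdot> proj N s j \<^bold>= zero \<^bold>\<longrightarrow> f \<cdot> (search \<cdot> f \<cdot> s) \<^bold>= zero"
  let ?cons = "Con (Cons N) \<cdot> Var ?a \<cdot> Var ?s'"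
  let ?C = "Var ?s \<^bold>= ?cons"
  let ?ctx = "\<lambda>\<Gamma> j. {?C, Ex ?s' ?C, Ex ?a (Ex ?s' ?C), f \<cdot> proj N (Var ?s) j \<^bold>= zero} \<union> \<Gamma>"
  have f_fresh [simp]: "x \<notin> fv_tm f" if "fst x \<ge> k" for x
    using k(1) that by auto
  \<comment> \<open>Common to both induction cases: the empty sequence is settled here, the nonempty
    one is left. \<open>?i\<close> may be free in \<open>\<Gamma>'\<close> because the induction
    hypothesis contains it.\<close>
  have step: "derives sysP \<Gamma>' (All ?s (?\<psi> j (Var ?s)))"
    if j: "j \<Colon> N" "fv_tm j \<subseteq> {?i}" and \<Gamma>': "\<forall>\<gamma>\<in>\<Gamma>'. \<forall>x\<in>fv \<gamma>. fst x < k \<or> x = ?i"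
      and cons: "derives sysP (?ctx \<Gamma>' j) (f \<cdot> (search \<cdot> f \<cdot> ?cons) \<^bold>= zero)" for \<Gamma>' j
  proof (intro AllI ImpI)
    let ?\<Gamma>1 = "insert (f \<cdot> proj N (Var ?s) j \<^bold>= zero) \<Gamma>'"
    show "derives sysP ?\<Gamma>1 (f \<cdot> (search \<cdot> f \<cdot> Var ?s) \<^bold>= zero)"
    proof (rule derives_Seq_cases[where t = "Var ?s" and a = ?a and s = ?s' and \<sigma> = N])
      let ?E = "insert (Var ?s \<^bold>= Con (Empty N)) ?\<Gamma>1"
      have e: "eqd ?E (Sq N) (Var ?s) (Con (Empty N))"
        by (simp add: eqd_def Hyp)
      \<comment> \<open>On the empty sequence the search and every component have the same value
        0.\<close>
      have "eqd ?E N (search \<cdot> f \<cdot> Var ?s) (search \<cdot> f \<cdot> Con (Empty N))"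
        by (rule eqd_arg[OF _ e]) (use f in simp)
      also have "eqd ?E N \<dots> (default N)"
        using eqd_search_Empty[OF f] by simp
      also have "eqd ?E N \<dots> (proj N (Con (Empty N)) j)"
        by (rule eqd_sym[OF eqd_proj_Empty[OF j(1)]])
      also have "eqd ?E N \<dots> (proj N (Var ?s) j)"
        by (rule eqd_proj[OF eqd_sym[OF e] eqd_refl[OF j(1)]])
      finally show "derives sysP ?E (f \<cdot> (search \<cdot> f \<cdot> Var ?s) \<^bold>= zero)"
        by (rule derives_zero_transport[rotated]) (use f j in \<open>simp_all add: Hyp has_type_proj\<close>)
      have "eqd (?ctx \<Gamma>' j) N (search \<cdot> f \<cdot> Var ?s) (search \<cdot> f \<cdot> ?cons)"
        by (rule eqd_arg) (use f in \<open>simp_all add: eqd_def Hyp\<close>)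
      then have "derives sysP (?ctx \<Gamma>' j) (f \<cdot> (search \<cdot> f \<cdot> Var ?s) \<^bold>= zero)"
        by (rule derives_zero_transport[OF cons _ f])
      then show "derives sysP ({?C, Ex ?s' ?C, Ex ?a (Ex ?s' ?C)} \<union> ?\<Gamma>1)
          (f \<cdot> (search \<cdot> f \<cdot> Var ?s) \<^bold>= zero)"
        by (simp add: insert_commute)
    qed (use j \<Gamma>' in force)+
  qed (use f j \<Gamma>' in \<open>force simp: has_type_proj\<close>)+
  show ?thesis
  proof (rule derives_induct)
    \<comment> \<open>At position 0 the head itself is a zero, and the search stops there.\<close>
    let ?\<Delta>0 = "?ctx \<Gamma> zero"
    have C: "eqd ?\<Delta>0 (Sq N) ?cons (Var ?s)"
      by (rule eqd_sym) (simp add: eqd_def Hyp)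
    have "eqd ?\<Delta>0 N (Var ?a) (proj N ?cons zero)"
      by (rule eqd_sym[OF eqd_proj_Cons_zero]) simp_all
    also have "eqd ?\<Delta>0 N \<dots> (proj N (Var ?s) zero)"
      by (rule eqd_proj[OF C eqd_refl]) simp
    finally have a: "derives sysP ?\<Delta>0 (f \<cdot> Var ?a \<^bold>= zero)"
      by (rule derives_zero_transport[rotated]) (use f in \<open>simp_all add: Hyp has_type_proj\<close>)
    let ?k = "Con (KC (N \<rightarrow> N) N) \<cdot> (Con (KC N N) \<cdot> (search \<cdot> f \<cdot> Var ?s'))"
    have "eqd ?\<Delta>0 N (search \<cdot> f \<cdot> ?cons) (Con (Rec N) \<cdot> (f \<cdot> Var ?a) \<cdot> Var ?a \<cdot> ?k)"
      by (rule eqd_search_Cons[OF f]) simp_all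
    also have "eqd ?\<Delta>0 N \<dots> (Con (Rec N) \<cdot> zero \<cdot> Var ?a \<cdot> ?k)"
      by (rule eqd_fun[OF _ eqd_fun[OF _ eqd_arg]]) (use f a in \<open>simp_all add: eqd_def\<close>)
    also have "eqd ?\<Delta>0 N \<dots> (Var ?a)"
      by (rule eqd_Rec_Zero) (use f in simp_all)
    finally have "derives sysP ?\<Delta>0 (f \<cdot> (search \<cdot> f \<cdot> ?cons) \<^bold>= zero)"
      by (rule derives_zero_transport[OF a _ f])
    then have "derives sysP \<Gamma> (All ?s (?\<psi> zero (Var ?s)))"
      by (intro step) (use k in auto)
    then show "derives sysP \<Gamma> (subst ?i zero (All ?s (?\<psi> (Var ?i) (Var ?s))))"
      by simp
    let ?IH = "All ?s (?\<psi> (Var ?i) (Var ?s))"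
    let ?\<Delta>1 = "?ctx (insert ?IH \<Gamma>) (succ (Var ?i))"
    have C: "eqd ?\<Delta>1 (Sq N) ?cons (Var ?s)"
      by (rule eqd_sym) (simp add: eqd_def Hyp)
    \<comment> \<open>Position \<open>i\<close> of the tail is position \<open>i + 1\<close> of the
      whole, so the induction hypothesis at \<open>?s'\<close> makes the search in the tail
      succeed.\<close>
    have "eqd ?\<Delta>1 N (proj N (Var ?s') (Var ?i)) (proj N ?cons (succ (Var ?i)))"
      by (rule eqd_sym[OF eqd_proj_Cons_succ]) simp_all
    also have "eqd ?\<Delta>1 N \<dots> (proj N (Var ?s) (succ (Var ?i)))"
      by (rule eqd_proj[OF C eqd_refl]) simp
    finally have p: "derives sysP ?\<Delta>1 (f \<cdot> proj N (Var ?s') (Var ?i) \<^bold>= zero)"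
      by (rule derives_zero_transport[rotated]) (use f in \<open>simp_all add: Hyp has_type_proj\<close>)
    have "derives sysP ?\<Delta>1 ?IH"
      by (rule Hyp) (use f in \<open>simp_all add: has_type_proj\<close>)
    then have "derives sysP ?\<Delta>1 (?\<psi> (Var ?i) (Var ?s'))"
      by (rule derives_AllE[where t = "Var ?s'"]) simp_all
    then have r: "derives sysP ?\<Delta>1 (f \<cdot> (search \<cdot> f \<cdot> Var ?s') \<^bold>= zero)"
      by (rule ImpE[OF _ p])
    \<comment> \<open>Whether the head or the result for the tail is returned, it is a zero. The
      index \<open>Suc (Suc k)\<close> exceeds all others in the context.\<close>
    have "derives sysP ?\<Delta>1 (f \<cdot> (Con (Rec N) \<cdot> (f \<cdot> Var ?a) \<cdot> Var ?a
        \<cdot> (Con (KC (N \<rightarrow> N) N) \<cdot> (Con (KC N N) \<cdot> (search \<cdot> f \<cdot> Var ?s')))) \<^bold>= zero)"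
      by (rule derives_zero_if[OF f _ _ r, where x = "(Suc (Suc k), N)"]) (use f k in force)+
    then have "derives sysP ?\<Delta>1 (f \<cdot> (search \<cdot> f \<cdot> ?cons) \<^bold>= zero)"
      by (rule derives_zero_transport[OF _ eqd_search_Cons[OF f] f]) simp_all
    then have "derives sysP (insert ?IH \<Gamma>) (All ?s (?\<psi> (succ (Var ?i)) (Var ?s)))"
      by (intro step) (use k in auto)
    then show "derives sysP (insert ?IH \<Gamma>) (subst ?i (succ (Var ?i)) ?IH)"
      by simp
  qed (use f k in \<open>force simp: has_type_proj\<close>)+
qed


section \<open>The two implications\<close>

lemma derives_cut: "derives T \<Gamma> \<phi> \<Longrightarrow> derives T (insert \<phi> \<Gamma>) \<psi> \<Longrightarrow> wff \<phi> \<Longrightarrow> derives T \<Gamma> \<psi>"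
  using ImpE ImpI by blast

lemma wff_mem: "t \<Colon> \<sigma> \<Longrightarrow> u \<Colon> Sq \<sigma> \<Longrightarrow> wff (mem \<sigma> t u)"
  by (simp add: mem_def less_def add_def len_def has_type_proj Let_def)

lemma fv_mem: "fv (mem \<sigma> t u) \<subseteq> fv_tm t \<union> fv_tm u"
  by (auto simp: mem_def less_def add_def len_def Let_def)

text \<open>Transfer is proved contrapositively: any zero of \<open>f\<close>, perhaps nonstandard,
  makes \<open>\<mu>(f)\<close> a zero, and this one is standard because \<open>\<mu>\<close> and
  \<open>f\<close> are.\<close>

lemma MU_imp_Pi01_TRANS: "sysP \<turnstile> ExSt var_mu (MU var_mu) \<^bold>\<longrightarrow> Pi01_TRANS"
proof -
  let ?f = "Var var_f" and ?n = "Var var_n" and ?\<mu> = "Var var_mu"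
  let ?z = "?f \<cdot> ?n \<^bold>= zero"
  let ?H = "St ?\<mu> \<^bold>\<and> MU var_mu"
  let ?\<Gamma> = "{?z, AllSt var_n (\<^bold>\<not> ?z), St ?f, Ex var_mu ?H}"
  let ?\<Delta> = "insert ?H ?\<Gamma>"
  have H: "derives sysP ?\<Delta> ?H"
    by (rule Hyp) (simp_all add: MU_def)
  have "derives sysP ?\<Delta> (All var_f (Ex var_n ?z \<^bold>\<longrightarrow> ?f \<cdot> (?\<mu> \<cdot> ?f) \<^bold>= zero))"
    using AndE2[OF H] by (simp only: MU_def)
  then have "derives sysP ?\<Delta> (Ex var_n ?z \<^bold>\<longrightarrow> ?f \<cdot> (?\<mu> \<cdot> ?f) \<^bold>= zero)"
    by (rule derives_AllE[where t = ?f]) simp_all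
  moreover have "derives sysP ?\<Delta> (Ex var_n ?z)"
    by (rule derives_ExI[OF Hyp, where t = ?n]) simp_all
  ultimately have zero: "derives sysP ?\<Delta> (?f \<cdot> (?\<mu> \<cdot> ?f) \<^bold>= zero)"
    by (rule ImpE)
  have "derives sysP ?\<Delta> (AllSt var_n (\<^bold>\<not> ?z))"
    by (rule Hyp) simp_all
  then have "derives sysP ?\<Delta> (St (?\<mu> \<cdot> ?f) \<^bold>\<longrightarrow> \<^bold>\<not> ?f \<cdot> (?\<mu> \<cdot> ?f) \<^bold>= zero)"
    by (rule derives_AllE[where t = "?\<mu> \<cdot> ?f"]) simp_all
  moreover have "derives sysP ?\<Delta> (St (?\<mu> \<cdot> ?f))"
    by (rule St_appI[OF AndE1[OF H] Hyp, of _ ty1 N]) simp_all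
  ultimately have "derives sysP ?\<Delta> (\<^bold>\<not> ?f \<cdot> (?\<mu> \<cdot> ?f) \<^bold>= zero)"
    by (rule ImpE)
  then have "derives sysP ?\<Delta> Bot"
    using zero by (rule ImpE)
  then have "derives sysP ?\<Gamma> Bot"
    by (rule ExE[where x = var_mu and \<phi> = ?H, OF Hyp, rotated 2]) (simp_all add: MU_def)
  then show ?thesis
    unfolding Pi01_TRANS_def by (intro ImpI AllI) (simp_all add: MU_def)
qed

text \<open>The context \<open>\<Gamma>\<close> of closed formulas lets the implication be derived
  under a further assumption, in place of a weakening rule.\<close>

lemma Pi01_TRANS_imp_rel_st_mu2:
  assumes \<Gamma>: "\<forall>\<gamma>\<in>\<Gamma>. fv \<gamma> = {}"
  shows "derives sysP \<Gamma> (Pi01_TRANS \<^bold>\<longrightarrow> rel_st mu2)"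
proof (rule ImpI)
  let ?f = "Var var_f" and ?n = "Var var_n"
  let ?z = "?f \<cdot> ?n \<^bold>= zero"
  \<comment> \<open>Internal, as \<open>HAC_int\<close> demands. The \<open>var_n\<close> of the
    antecedent is bound; that of the consequent is the value to be chosen.\<close>
  let ?\<phi> = "Ex var_n ?z \<^bold>\<longrightarrow> ?z"
  let ?\<Gamma>1 = "insert Pi01_TRANS \<Gamma>"
  have wff_TRANS [simp]: "wff Pi01_TRANS" and fv_TRANS [simp]: "fv Pi01_TRANS = {}"
    by (auto simp: Pi01_TRANS_def)
  show "wff Pi01_TRANS" by simp

  \<comment> \<open>If no standard \<open>n\<close> satisfied \<open>?\<phi>\<close>, then
    \<open>f\<close> would have no standard zero, hence by Transfer no zero at all, and the standard
    number 0 would satisfy \<open>?\<phi>\<close> vacuously.\<close>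
  have std_witness: "derives sysP ?\<Gamma>1 (AllSt var_f (ExSt var_n ?\<phi>))"
  proof (rule AllI, rule ImpI, rule RAA)
    let ?\<Gamma>2 = "insert (\<^bold>\<not> ExSt var_n ?\<phi>) (insert (St ?f) ?\<Gamma>1)"
    let ?A = "All var_n (\<^bold>\<not> ?z)"
    have no_std_zero: "derives sysP ?\<Gamma>2 (AllSt var_n (\<^bold>\<not> ?z))"
    proof (intro AllI ImpI)
      let ?\<Delta> = "insert ?z (insert (St ?n) ?\<Gamma>2)"
      have "derives sysP ?\<Delta> (\<^bold>\<not> ExSt var_n ?\<phi>)"
        by (rule Hyp) simp_all
      moreover have "derives sysP ?\<Delta> (ExSt var_n ?\<phi>)"
        by (rule derives_ExI[where t = ?n], rule AndI[OF Hyp ImpI[OF Hyp]]) simp_all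
      ultimately show "derives sysP ?\<Delta> Bot"
        by (rule ImpE)
    qed (use \<Gamma> in simp_all)
    have "derives sysP ?\<Gamma>2 (AllSt var_f (AllSt var_n (\<^bold>\<not> ?z) \<^bold>\<longrightarrow> ?A))"
      by (rule Hyp) (simp_all add: Pi01_TRANS_def)
    then have "derives sysP ?\<Gamma>2 (St ?f \<^bold>\<longrightarrow> AllSt var_n (\<^bold>\<not> ?z) \<^bold>\<longrightarrow> ?A)"
      by (rule derives_AllE[where t = ?f]) simp_all
    then have "derives sysP ?\<Gamma>2 (AllSt var_n (\<^bold>\<not> ?z) \<^bold>\<longrightarrow> ?A)"
      by (rule ImpE) (rule Hyp; simp)
    then have no_zero: "derives sysP ?\<Gamma>2 ?A"
      using no_std_zero by (rule ImpE)
    have "derives sysP (insert ?A ?\<Gamma>2) Bot"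
    proof (rule ImpE)
      let ?\<Delta> = "insert (\<^bold>\<not> ?f \<cdot> zero \<^bold>= zero) (insert (Ex var_n ?z) (insert ?A ?\<Gamma>2))"
      have "derives sysP (insert ?z ?\<Delta>) (\<^bold>\<not> ?z)"
        by (rule derives_AllE[where x = var_n and \<phi> = "\<^bold>\<not> ?z" and t = ?n, OF Hyp]) simp_all
      then have "derives sysP (insert ?z ?\<Delta>) Bot"
        by (rule ImpE) (rule Hyp; simp)
      then have "derives sysP ?\<Delta> Bot"
        by (rule ExE[where x = var_n and \<phi> = ?z, OF Hyp, rotated 2]) (use \<Gamma> in simp_all)
      then have "derives sysP (insert ?A ?\<Gamma>2) (Ex var_n ?z \<^bold>\<longrightarrow> ?f \<cdot> zero \<^bold>= zero)"
        by (rule ImpI[OF RAA]) simp_all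
      then show "derives sysP (insert ?A ?\<Gamma>2) (ExSt var_n ?\<phi>)"
        by (intro derives_ExI[where t = zero and \<psi> = "St zero \<^bold>\<and> (Ex var_n ?z \<^bold>\<longrightarrow> ?f \<cdot> zero \<^bold>= zero)"]
            AndI St_closedI) simp_all
      show "derives sysP (insert ?A ?\<Gamma>2) (\<^bold>\<not> ExSt var_n ?\<phi>)"
        by (rule Hyp) simp_all
    qed
    then show "derives sysP ?\<Gamma>2 Bot"
      by (rule derives_cut[OF no_zero]) simp
  qed (use \<Gamma> in simp_all)

  \<comment> \<open>Index 1 is what \<open>mem\<close> picks for its bound position and what
    \<open>derives_search\<close> yields for \<open>k = 1\<close>.\<close>
  let ?vF = "(0, ty1 \<rightarrow> Sq N) :: var" and ?i = "(1, N) :: var" and ?s = "(1, Sq N) :: var"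
  let ?F = "Var ?vF"
  let ?m = "mem N ?n (?F \<cdot> ?f)"
  let ?W = "AllSt var_f (Ex var_n (?m \<^bold>\<and> ?\<phi>))"
  have wff_m [simp]: "wff ?m"
    by (rule wff_mem) simp_all
  have fv_m: "fv ?m \<subseteq> {var_n, ?vF, var_f}"
    using fv_mem[of N ?n "?F \<cdot> ?f"] by auto
  have "(AllSt var_f (ExSt var_n ?\<phi>) \<^bold>\<longrightarrow> ExSt ?vF ?W) \<in> sysP"
    by (rule sysP.HAC_int[of _ _ ty1 _ N]) simp_all
  then have choice: "derives sysP ?\<Gamma>1 (ExSt ?vF ?W)"
    by (rule ImpE[OF Axiom std_witness])

  \<comment> \<open>By the equation of S this sends \<open>f\<close> to the search of
    \<open>F(f)\<close>; it is standard, being built from closed terms and the standard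
    \<open>F\<close>.\<close>
  let ?\<mu> = "Con (SC ty1 (Sq N) N) \<cdot> search \<cdot> ?F"
  let ?R = "ExSt var_n ?z \<^bold>\<longrightarrow> ?f \<cdot> (?\<mu> \<cdot> ?f) \<^bold>= zero"
  let ?\<Gamma>3 = "insert (St ?F \<^bold>\<and> ?W) ?\<Gamma>1"
  let ?\<Gamma>4 = "insert (ExSt var_n ?z) (insert (St ?f) ?\<Gamma>3)"
  let ?E = "Ex var_n ?z"
  let ?S = "All ?i (All ?s (?f \<cdot> proj N (Var ?s) (Var ?i) \<^bold>= zero
    \<^bold>\<longrightarrow> ?f \<cdot> (search \<cdot> ?f \<cdot> Var ?s) \<^bold>= zero))"
  let ?\<Gamma>5 = "insert ?S (insert ?E ?\<Gamma>4)"
  have St_\<mu>: "derives sysP ?\<Gamma>3 (St ?\<mu>)"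
    by (rule St_appI[OF St_closedI AndE1[where \<psi> = ?W, OF Hyp], where \<sigma> = "ty1 \<rightarrow> Sq N" and \<tau> = ty2]) simp_all
  \<comment> \<open>The premise of \<open>?R\<close> gives a standard zero, the antecedent of
    \<open>?\<phi>\<close> only asks for a zero.\<close>
  have E: "derives sysP ?\<Gamma>4 ?E"
    by (rule ExE[where x = var_n and \<phi> = "St ?n \<^bold>\<and> ?z", OF Hyp],
        simp, simp, rule derives_ExI[where t = ?n, OF AndE2[where \<phi> = "St ?n", OF Hyp]]) (use \<Gamma> in simp_all)
  \<comment> \<open>Obtained before the position \<open>?i\<close> becomes free in the context: here
    all free variables have index 0, below \<open>k = 1\<close>.\<close>
  have S: "derives sysP (insert ?E ?\<Gamma>4) ?S"
    by (rule derives_search) (use \<Gamma> fv_m in auto)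
  have "derives sysP ?\<Gamma>5 (?f \<cdot> (?\<mu> \<cdot> ?f) \<^bold>= zero)"
  proof (rule ExE)
    have "derives sysP ?\<Gamma>5 ?W"
      by (rule AndE2[where \<phi> = "St ?F", OF Hyp]) simp_all
    then have "derives sysP ?\<Gamma>5 (St ?f \<^bold>\<longrightarrow> Ex var_n (?m \<^bold>\<and> ?\<phi>))"
      by (rule derives_AllE[where t = ?f]) simp_all
    then show "derives sysP ?\<Gamma>5 (Ex var_n (?m \<^bold>\<and> ?\<phi>))"
      by (rule ImpE) (rule Hyp; simp)
    let ?\<Gamma>6 = "insert (?m \<^bold>\<and> ?\<phi>) ?\<Gamma>5"
    let ?p = "less (Var ?i) (len N (?F \<cdot> ?f)) \<^bold>\<and> ?n \<^bold>= proj N (?F \<cdot> ?f) (Var ?i)"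
    have m_eq: "?m = Ex ?i ?p"
      by (simp add: mem_def Let_def)
    have wff_p: "wff ?p"
      using wff_m unfolding m_eq by simp
    show "derives sysP ?\<Gamma>6 (?f \<cdot> (?\<mu> \<cdot> ?f) \<^bold>= zero)"
    proof (rule ExE)
      show "derives sysP ?\<Gamma>6 (Ex ?i ?p)"
        unfolding m_eq[symmetric] by (rule AndE1[where \<psi> = ?\<phi>, OF Hyp]) simp_all
      let ?\<Delta> = "insert ?p ?\<Gamma>6"
      \<comment> \<open>As \<open>f\<close> has a zero, \<open>?\<phi>\<close> makes the chosen
        component \<open>n\<close> of \<open>F(f)\<close> one, and \<open>?S\<close> passes this on
        to the result of the search.\<close>
      have "derives sysP ?\<Delta> ?z"
        by (rule ImpE[where \<phi> = ?E, OF AndE2[where \<phi> = ?m, OF Hyp] Hyp]) simp_all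
      moreover have "derives sysP ?\<Delta> (?n \<^bold>= proj N (?F \<cdot> ?f) (Var ?i))"
        by (rule AndE2[OF Hyp[OF insertI1 wff_p]])
      then have "eqd ?\<Delta> N (proj N (?F \<cdot> ?f) (Var ?i)) ?n"
        using eqd_sym[of ?\<Delta> N ?n] by (simp add: eqd_def has_type_proj)
      ultimately have zero: "derives sysP ?\<Delta> (?f \<cdot> proj N (?F \<cdot> ?f) (Var ?i) \<^bold>= zero)"
        by (rule derives_zero_transport) simp
      have "derives sysP ?\<Delta> ?S"
        by (rule Hyp) (simp_all add: has_type_proj)
      then have "derives sysP ?\<Delta> (All ?s (?f \<cdot> proj N (Var ?s) (Var ?i) \<^bold>= zero
          \<^bold>\<longrightarrow> ?f \<cdot> (search \<cdot> ?f \<cdot> Var ?s) \<^bold>= zero))"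
        by (rule derives_AllE[where t = "Var ?i"]) simp_all
      then have "derives sysP ?\<Delta> (?f \<cdot> proj N (?F \<cdot> ?f) (Var ?i) \<^bold>= zero
          \<^bold>\<longrightarrow> ?f \<cdot> (search \<cdot> ?f \<cdot> (?F \<cdot> ?f)) \<^bold>= zero)"
        by (rule derives_AllE[where t = "?F \<cdot> ?f"]) simp_all
      then have "derives sysP ?\<Delta> (?f \<cdot> (search \<cdot> ?f \<cdot> (?F \<cdot> ?f)) \<^bold>= zero)"
        using zero by (rule ImpE)
      then show "derives sysP ?\<Delta> (?f \<cdot> (?\<mu> \<cdot> ?f) \<^bold>= zero)"
        by (rule derives_zero_transport[OF _ eqd_S]) simp_all
    qed (use \<Gamma> fv_m in auto)
  qed (use \<Gamma> in auto)
  then have "derives sysP (insert ?E ?\<Gamma>4) (?f \<cdot> (?\<mu> \<cdot> ?f) \<^bold>= zero)"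
    by (rule derives_cut[OF S]) (simp add: has_type_proj)
  then have "derives sysP ?\<Gamma>4 (?f \<cdot> (?\<mu> \<cdot> ?f) \<^bold>= zero)"
    by (rule derives_cut[OF E]) simp
  then have "derives sysP ?\<Gamma>3 (AllSt var_f ?R)"
    by (intro AllI ImpI) (use \<Gamma> in auto)
  then have "derives sysP ?\<Gamma>3 (St ?\<mu> \<^bold>\<and> AllSt var_f ?R)"
    by (rule AndI[OF St_\<mu>])
  then have "derives sysP ?\<Gamma>3 (rel_st mu2)"
    unfolding mu2_def MU_def rel_st.simps by (rule derives_ExI[where t = ?\<mu>]) simp_all
  then show "derives sysP ?\<Gamma>1 (rel_st mu2)"
    by (rule ExE[OF choice]) (use \<Gamma> in \<open>auto simp: mu2_def MU_def\<close>)
qed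

theorem theorem2p19:
  shows "(sysP \<turnstile> ExSt var_mu (MU var_mu) \<^bold>\<longrightarrow> Pi01_TRANS)
    \<and> (sysP \<turnstile> Pi01_TRANS \<^bold>\<longrightarrow> rel_st mu2)
    \<and> (sysP \<turnstile> ExSt var_mu (MU var_mu) \<^bold>\<longrightarrow> Pi01_TRANS \<^bold>\<longrightarrow> rel_st mu2)"
proof (intro conjI)
  show "sysP \<turnstile> ExSt var_mu (MU var_mu) \<^bold>\<longrightarrow> Pi01_TRANS"
    by (rule MU_imp_Pi01_TRANS)
  show "sysP \<turnstile> Pi01_TRANS \<^bold>\<longrightarrow> rel_st mu2"
    by (rule Pi01_TRANS_imp_rel_st_mu2) simp
  \<comment> \<open>The first hypothesis is closed and can therefore serve as the context.\<close>
  show "sysP \<turnstile> ExSt var_mu (MU var_mu) \<^bold>\<longrightarrow> Pi01_TRANS \<^bold>\<longrightarrow> rel_st mu2"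
    by (rule ImpI[OF Pi01_TRANS_imp_rel_st_mu2]) (auto simp: MU_def)
qed

end
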